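(* Let $R$ be a finite associative ring with unity, let $J$ be its Jacobson radical, and let $\mathcal{N}(R)$ be its null ideal. If the nilpotency of $J$ is at most $3$, then $\mathcal{N}(R)$ is a two-sided ideal of $R[x]$.
   Context: $R[x]$ is the ring of polynomials over $R$ in a central indeterminate $x$ (so $x$ commutes with all coefficients; $R$ need not be commutative). Polynomials satisfy right evaluation: to evaluate, write $f(x)=\sum_i c_i x^i$ with the powers of $x$ to the right of the coefficients, and set $f(a)=\sum_i c_i a^i$ for $a\in R$. The null ideal is $\mathcal{N}(R)=\{f\in R[x] \mid f(a)=0 \text{ for all } a\in R\}$. Since $R$ is finite, $J$ is nilpotent; the nilpotency of $J$ is the smallest positive integer $n$ such that $J^n=\{0\}$. *)

theory Defs
  imports "HOL-Algebra.UnivPoly" "HOL-Algebra.Ideal_Product"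
begin

definition left_ideal :: "'a set \<Rightarrow> ('a, 'm) ring_scheme \<Rightarrow> bool" where
  "left_ideal I R \<longleftrightarrow>
     additive_subgroup I R \<and> (\<forall>x \<in> carrier R. \<forall>a \<in> I. x \<otimes>\<^bsub>R\<^esub> a \<in> I)"

definition maximal_left_ideal :: "'a set \<Rightarrow> ('a, 'm) ring_scheme \<Rightarrow> bool" where
  "maximal_left_ideal M R \<longleftrightarrow>
     left_ideal M R \<and> M \<noteq> carrier R \<and>
     (\<forall>I. left_ideal I R \<and> M \<subseteq> I \<longrightarrow> I = M \<or> I = carrier R)"

text \<open>Intersecting with the carrier only matters for the zero ring, which has no maximal
  left ideals; there the radical is the whole ring.\<close>

definition jacobson_radical :: "('a, 'm) ring_scheme \<Rightarrow> 'a set" where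
  "jacobson_radical R = carrier R \<inter> \<Inter>{M. maximal_left_ideal M R}"

primrec ideal_power :: "('a, 'm) ring_scheme \<Rightarrow> 'a set \<Rightarrow> nat \<Rightarrow> 'a set" where
  "ideal_power R I 0 = carrier R"
| "ideal_power R I (Suc n) = ideal_prod R (ideal_power R I n) I"

text \<open>Meaningful only for nilpotent \<open>I\<close>, such as the Jacobson radical of a finite ring;
  otherwise the value is unspecified.\<close>

definition nilpotency :: "('a, 'm) ring_scheme \<Rightarrow> 'a set \<Rightarrow> nat" where
  "nilpotency R I = (LEAST n. 0 < n \<and> ideal_power R I n = {\<zero>\<^bsub>R\<^esub>})"

text \<open>\<open>UP R\<close> is a ring for every, possibly noncommutative, ring \<open>R\<close>, and its indeterminate
  commutes with the coefficients. The term \<open>eval R R id a f\<close> is the sum of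
  \<open>c\<^sub>i \<otimes> a [^] i\<close> with the coefficient on the left, that is, right evaluation; for
  noncommutative \<open>R\<close> it is in general not multiplicative in \<open>f\<close>.\<close>

definition null_ideal :: "('a, 'm) ring_scheme \<Rightarrow> (nat \<Rightarrow> 'a) set" where
  "null_ideal R =
     {f \<in> carrier (UP R). \<forall>a \<in> carrier R. eval R R id a f = \<zero>\<^bsub>R\<^esub>}"

end

theory Submission
  imports Defs
begin

text \<open>
The null ideal \<open>N\<close> is always a left ideal, and it is closed under right multiplication by the
central indeterminate. So the question is whether \<open>f \<cdot> r \<in> N\<close> for \<open>f \<in> N\<close> and constant \<open>r\<close>. The
\<open>r\<close> for which this holds for all \<open>f \<in> N\<close> form a subring \<open>T\<close> of \<open>R\<close>. It contains the units, since
\<open>(f u)(a) = f(u a u\<^sup>-\<^sup>1) u\<close>, and therefore all nilpotent elements \<open>z = \<one> \<ominus> (\<one> \<ominus> z)\<close>.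

By Fitting's decomposition \<open>R\<close> is generated by units and idempotents, so it remains to treat an
idempotent \<open>e\<close> with complement \<open>d = \<one> \<ominus> e\<close>. The Peirce components \<open>eRd\<close> and \<open>dRe\<close> consist of
elements of square zero and lie in \<open>T\<close>. When a product of an element of \<open>eRd\<close> with one of \<open>dRe\<close> is not
nilpotent, one of its powers is a nonzero idempotent of \<open>T\<close> that can be split off from \<open>e\<close>, so by induction
one may assume that all these products are nilpotent
(\<open>generated_by_units_and_idempotents_with_nil_corner\<close>). Then \<open>eRd\<close> and \<open>dRe\<close> lie in the radical \<open>J\<close>
(\<open>nilpotent_peirce_in_jacobson_radical\<close>).

This is where nilpotency at most \<open>3\<close> enters: products of three off-diagonal blocks vanish.
Write \<open>a\<close> as a block matrix with respect to \<open>e\<close> and \<open>d\<close>. In every power of \<open>a\<close>, the off-diagonal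
blocks then agree with those of the same power of the triangular parts of \<open>a\<close>, and subtracting
the diagonal part isolates them (\<open>off_diagonal_block_of_power\<close>). As \<open>f\<close> vanishes at \<open>a\<close>, at its
triangular parts and at its diagonal part, this gives \<open>\<Sum> f\<^sub>i e a\<^sup>i = 0\<close>
(\<open>idempotent_null_ideal_multiplier\<close>). The diagonal block of a power of \<open>a\<close> needs no separate
analysis: it is what is left of a column of \<open>a\<^sup>i\<close> when the off-diagonal block is removed.
\<close>

section \<open>Idempotents and nilpotents in a finite ring\<close>

context ring
begin

definition nilpotent_elem :: "'a \<Rightarrow> bool" where
  "nilpotent_elem x \<longleftrightarrow> (\<exists>n::nat. x [^] n = \<zero>)"

definition complementary_idempotents :: "'a \<Rightarrow> 'a \<Rightarrow> bool" where
  "complementary_idempotents e d \<longleftrightarrow>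
     e \<in> carrier R \<and> d \<in> carrier R \<and> e \<otimes> d = \<zero> \<and> d \<otimes> e = \<zero> \<and> e \<oplus> d = \<one>"

lemma complementary_idempotents_sym:
  "complementary_idempotents e d \<Longrightarrow> complementary_idempotents d e"
  by (auto simp: complementary_idempotents_def a_comm)

lemma complementary_idempotents_idem:
  assumes "complementary_idempotents e d"
  shows "e \<otimes> e = e" "d \<otimes> d = d"
proof -
  have c: "e \<in> carrier R" "d \<in> carrier R" "e \<otimes> d = \<zero>" "d \<otimes> e = \<zero>" "e \<oplus> d = \<one>"
    using assms by (auto simp: complementary_idempotents_def)
  have "e \<otimes> (e \<oplus> d) = e" "d \<otimes> (e \<oplus> d) = d" unfolding c(5) using c by auto
  then show "e \<otimes> e = e" "d \<otimes> d = d" using c(1-4) by (simp_all add: r_distr)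
qed

lemma complementary_idempotents_one_minus:
  assumes "e \<in> carrier R" "e \<otimes> e = e"
  shows "complementary_idempotents e (\<one> \<ominus> e)"
  using assms
  by (auto simp: complementary_idempotents_def minus_eq r_distr l_distr l_minus r_minus r_neg a_lcomm[of e])

lemma unit_one_minus_nilpotent:
  assumes x: "x \<in> carrier R" and "nilpotent_elem x"
  shows "\<one> \<ominus> x \<in> Units R"
proof -
  obtain n :: nat where n: "x [^] n = \<zero>" using assms by (auto simp: nilpotent_elem_def)
  have "\<exists>s \<in> carrier R. (\<one> \<ominus> x) \<otimes> s = \<one> \<ominus> x [^] m \<and> s \<otimes> (\<one> \<ominus> x) = \<one> \<ominus> x [^] m" for m :: nat
  proof (induction m)
    case 0
    show ?case using x by (intro bexI[of _ \<zero>]) (auto simp: minus_eq r_neg)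
  next
    case (Suc m)
    then obtain s where s: "s \<in> carrier R" "(\<one> \<ominus> x) \<otimes> s = \<one> \<ominus> x [^] m"
      "s \<otimes> (\<one> \<ominus> x) = \<one> \<ominus> x [^] m" by blast
    have comm: "x \<otimes> x [^] m = x [^] m \<otimes> x" using x by (metis nat_pow_Suc nat_pow_Suc2)
    show ?case
    proof (intro bexI[of _ "s \<oplus> x [^] m"] conjI)
      have "(\<one> \<ominus> x) \<otimes> (s \<oplus> x [^] m) = (\<one> \<ominus> x [^] m) \<oplus> (\<one> \<ominus> x) \<otimes> x [^] m"
        using x s by (simp add: r_distr)
      also have "\<dots> = \<one> \<ominus> x [^] Suc m"
        using x by (simp add: minus_eq l_distr l_minus comm a_assoc r_neg1 )
      finally show "(\<one> \<ominus> x) \<otimes> (s \<oplus> x [^] m) = \<one> \<ominus> x [^] Suc m" .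
      have "(s \<oplus> x [^] m) \<otimes> (\<one> \<ominus> x) = (\<one> \<ominus> x [^] m) \<oplus> x [^] m \<otimes> (\<one> \<ominus> x)"
        using x s by (simp add: l_distr)
      also have "\<dots> = \<one> \<ominus> x [^] Suc m"
        using x by (simp add: minus_eq r_distr r_minus a_assoc r_neg1)
      finally show "(s \<oplus> x [^] m) \<otimes> (\<one> \<ominus> x) = \<one> \<ominus> x [^] Suc m" .
    qed (use x s in auto)
  qed
  from this[of n] obtain s where "s \<in> carrier R" "(\<one> \<ominus> x) \<otimes> s = \<one>" "s \<otimes> (\<one> \<ominus> x) = \<one>"
    using n by (auto simp: minus_eq)
  then show ?thesis using x by (auto simp: Units_def)
qed

lemma nilpotent_elem_swap:
  assumes x: "x \<in> carrier R" and y: "y \<in> carrier R" and "nilpotent_elem (x \<otimes> y)"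
  shows "nilpotent_elem (y \<otimes> x)"
proof -
  obtain n :: nat where n: "(x \<otimes> y) [^] n = \<zero>" using assms by (auto simp: nilpotent_elem_def)
  have "(y \<otimes> x) [^] Suc m = y \<otimes> (x \<otimes> y) [^] m \<otimes> x" for m :: nat
  proof (induction m)
    case (Suc m)
    then have "(y \<otimes> x) [^] Suc (Suc m) = y \<otimes> (x \<otimes> y) [^] m \<otimes> x \<otimes> (y \<otimes> x)"
      by simp
    then show ?case using x y by (simp add: m_assoc)
  qed (use x y in auto)
  then have "(y \<otimes> x) [^] Suc n = \<zero>" using n x y by simp
  then show ?thesis unfolding nilpotent_elem_def by blast
qed

text \<open>Moving factors cyclically does not affect nilpotency: \<open>z \<otimes> x\<close> is nilpotent if \<open>x \<otimes> z = e \<otimes> (x \<otimes> z)\<close> is, and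
this in turn if \<open>x \<otimes> z \<otimes> e\<close> is.\<close>

lemma nilpotent_elem_sandwich:
  assumes e: "e \<in> carrier R" and z: "z \<in> carrier R" and "e \<otimes> x = x" "x \<in> carrier R"
    and "nilpotent_elem (x \<otimes> (z \<otimes> e))"
  shows "nilpotent_elem (z \<otimes> x)"
  by (metis assms m_assoc m_closed nilpotent_elem_swap)

text \<open>The powers of \<open>r\<close> are eventually periodic. An exponent that is a multiple of the period and
lies past the preperiod is unchanged, up to the value of the power, by doubling.\<close>

lemma idempotent_power:
  assumes fin: "finite (carrier R)" and r: "r \<in> carrier R"
  shows "\<exists>n::nat. 0 < n \<and> r [^] n \<otimes> r [^] n = r [^] n"
proof -
  have "\<not> inj_on (\<lambda>n::nat. r [^] n) UNIV"
    using fin r finite_imageD[of "\<lambda>n::nat. r [^] n" UNIV]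
    by (meson finite_subset image_subsetI infinite_UNIV_nat nat_pow_closed)
  then obtain i j :: nat where "i < j" and ij: "r [^] i = r [^] j"
    by (metis injI linorder_neqE_nat)
  define p where "p = j - i"
  have p: "0 < p" "j = i + p" using \<open>i < j\<close> by (auto simp: p_def)
  have shift: "r [^] (k + p) = r [^] k" if "i \<le> k" for k
  proof -
    have "r [^] (k + p) = r [^] j \<otimes> r [^] (k - i)"
      using that p r by (simp add: nat_pow_mult add.commute)
    also have "\<dots> = r [^] k" using that r by (simp add: ij[symmetric] nat_pow_mult)
    finally show ?thesis .
  qed
  have many: "r [^] (k + t * p) = r [^] k" if "i \<le> k" for k t
  proof (induction t)
    case (Suc t)
    have "r [^] (k + Suc t * p) = r [^] ((k + t * p) + p)" by (simp add: algebra_simps)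
    with Suc shift[of "k + t * p"] that show ?case by simp
  qed simp
  define n where "n = Suc i * p"
  have "i \<le> n" using p(1) by (cases p) (auto simp: n_def)
  then have "r [^] n \<otimes> r [^] n = r [^] n"
    using many[of n "Suc i"] r by (simp add: nat_pow_mult n_def[symmetric] del: mult_Suc)
  moreover have "0 < n" using p by (simp add: n_def)
  ultimately show ?thesis by blast
qed


section \<open>The Jacobson radical of a finite ring\<close>

text \<open>Closure under additive inverses is automatic, since \<open>\<ominus> a = (\<ominus> \<one>) \<otimes> a\<close>.\<close>

lemma left_ideal_iff:
  "left_ideal I R \<longleftrightarrow> I \<subseteq> carrier R \<and> \<zero> \<in> I \<and> (\<forall>a \<in> I. \<forall>b \<in> I. a \<oplus> b \<in> I) \<and>
     (\<forall>x \<in> carrier R. \<forall>a \<in> I. x \<otimes> a \<in> I)"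
proof
  assume "left_ideal I R"
  then have "additive_subgroup I R" and l: "\<forall>x \<in> carrier R. \<forall>a \<in> I. x \<otimes> a \<in> I"
    by (auto simp: left_ideal_def)
  then interpret additive_subgroup I R by simp
  show "I \<subseteq> carrier R \<and> \<zero> \<in> I \<and> (\<forall>a \<in> I. \<forall>b \<in> I. a \<oplus> b \<in> I) \<and>
     (\<forall>x \<in> carrier R. \<forall>a \<in> I. x \<otimes> a \<in> I)"
    using a_subset l by auto
next
  assume I: "I \<subseteq> carrier R \<and> \<zero> \<in> I \<and> (\<forall>a \<in> I. \<forall>b \<in> I. a \<oplus> b \<in> I) \<and>
     (\<forall>x \<in> carrier R. \<forall>a \<in> I. x \<otimes> a \<in> I)"
  have "\<ominus> a \<in> I" if "a \<in> I" for a
  proof -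
    have "\<ominus> a = (\<ominus> \<one>) \<otimes> a" using that I by (auto simp: l_minus)
    then show ?thesis using that I by (metis a_inv_closed one_closed)
  qed
  then have "additive_subgroup I R"
    using I by (intro additive_subgroupI add.subgroupI) (auto simp: a_inv_def[symmetric])
  then show "left_ideal I R" using I by (auto simp: left_ideal_def)
qed

lemma proper_left_ideal_in_maximal:
  assumes fin: "finite (carrier R)" and "left_ideal I R" "I \<noteq> carrier R"
  shows "\<exists>M. maximal_left_ideal M R \<and> I \<subseteq> M"
proof -
  define S where "S = {M. left_ideal M R \<and> M \<noteq> carrier R \<and> I \<subseteq> M}"
  have "finite S" "S \<noteq> {}"
    using assms finite_subset[of S "Pow (carrier R)"] by (auto simp: S_def left_ideal_iff)
  then obtain M where M: "M \<in> S" "\<And>N. N \<in> S \<Longrightarrow> M \<subseteq> N \<Longrightarrow> N = M"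
    using finite_has_maximal[of S] by metis
  then have "maximal_left_ideal M R"
    unfolding maximal_left_ideal_def S_def by blast
  then show ?thesis using M(1) by (auto simp: S_def)
qed

lemma jacobson_radical_closed: "jacobson_radical R \<subseteq> carrier R"
  by (auto simp: jacobson_radical_def)

lemma left_ideal_jacobson_radical: "left_ideal (jacobson_radical R) R"
  unfolding left_ideal_iff jacobson_radical_def maximal_left_ideal_def by auto

lemma left_ideal_principal:
  assumes y: "y \<in> carrier R"
  shows "left_ideal ((\<lambda>u. u \<otimes> y) ` carrier R) R"
  unfolding left_ideal_iff
proof (intro conjI ballI)
  show "(\<lambda>u. u \<otimes> y) ` carrier R \<subseteq> carrier R" using y by auto
  show "\<zero> \<in> (\<lambda>u. u \<otimes> y) ` carrier R" using y by (intro image_eqI[of _ _ \<zero>]) auto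
  fix a assume "a \<in> (\<lambda>u. u \<otimes> y) ` carrier R"
  then obtain u where u: "u \<in> carrier R" "a = u \<otimes> y" by blast
  show "x \<otimes> a \<in> (\<lambda>u. u \<otimes> y) ` carrier R" if "x \<in> carrier R" for x
    using that u y by (intro image_eqI[of _ _ "x \<otimes> u"]) (simp_all add: m_assoc)
  show "a \<oplus> b \<in> (\<lambda>u. u \<otimes> y) ` carrier R" if b: "b \<in> (\<lambda>u. u \<otimes> y) ` carrier R" for b
  proof -
    obtain v where "v \<in> carrier R" "b = v \<otimes> y" using b by blast
    then show ?thesis using u y by (intro image_eqI[of _ _ "u \<oplus> v"]) (simp_all add: l_distr)
  qed
qed

lemma jacobson_radical_left_inverse:
  assumes fin: "finite (carrier R)" and k: "k \<in> jacobson_radical R"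
  shows "\<exists>u \<in> carrier R. u \<otimes> (\<one> \<ominus> k) = \<one>"
proof (rule ccontr)
  assume no: "\<not> ?thesis"
  have kc: "k \<in> carrier R" using k jacobson_radical_closed by blast
  define I where "I = (\<lambda>u. u \<otimes> (\<one> \<ominus> k)) ` carrier R"
  have "left_ideal I R" unfolding I_def using kc by (intro left_ideal_principal) simp
  moreover have "\<one> \<notin> I" using no by (auto simp: I_def)
  then have "I \<noteq> carrier R" using one_closed by metis
  ultimately obtain M where M: "maximal_left_ideal M R" "I \<subseteq> M"
    using proper_left_ideal_in_maximal[OF fin] by blast
  have lM: "left_ideal M R" and "M \<noteq> carrier R" using M by (auto simp: maximal_left_ideal_def)
  have "k \<in> M" using k M by (auto simp: jacobson_radical_def)
  moreover have "\<one> \<ominus> k \<in> I" unfolding I_def using kc by (intro image_eqI[of _ _ \<one>]) auto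
  ultimately have "(\<one> \<ominus> k) \<oplus> k \<in> M" using lM M(2) by (auto simp: left_ideal_iff)
  moreover have "(\<one> \<ominus> k) \<oplus> k = \<one>" using kc by (simp add: minus_eq a_assoc l_neg)
  ultimately have "x \<in> M" if "x \<in> carrier R" for x
    using lM that r_one[OF that] unfolding left_ideal_iff by metis
  then show False using lM \<open>M \<noteq> carrier R\<close> by (auto simp: left_ideal_iff)
qed

text \<open>If a maximal left ideal \<open>M\<close> missed \<open>x\<close>, then \<open>M + R x\<close> would be all of \<open>R\<close>, and \<open>M\<close> would contain
some \<open>\<one> \<ominus> r \<otimes> x\<close>, which is a unit.\<close>

lemma nil_left_ideal_in_jacobson_radical:
  assumes x: "x \<in> carrier R" and nil: "\<And>r. r \<in> carrier R \<Longrightarrow> nilpotent_elem (r \<otimes> x)"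
  shows "x \<in> jacobson_radical R"
proof -
  have "x \<in> M" if M: "maximal_left_ideal M R" for M
  proof (rule ccontr)
    assume "x \<notin> M"
    have lM: "left_ideal M R" and proper: "M \<noteq> carrier R" using M by (auto simp: maximal_left_ideal_def)
    define I where "I = (\<lambda>(m, r). m \<oplus> r \<otimes> x) ` (M \<times> carrier R)"
    have I: "m \<oplus> r \<otimes> x \<in> I" if "m \<in> M" "r \<in> carrier R" for m r
      using that by (auto simp: I_def)
    have "left_ideal I R"
      unfolding left_ideal_iff
    proof (intro conjI ballI)
      show "I \<subseteq> carrier R" using lM x by (auto simp: I_def left_ideal_iff)
      show "\<zero> \<in> I" using I[of \<zero> \<zero>] lM x by (auto simp: left_ideal_iff)
      fix a assume "a \<in> I"
      then obtain m r where a: "a = m \<oplus> r \<otimes> x" "m \<in> M" "r \<in> carrier R" "m \<in> carrier R"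
        using lM by (auto simp: I_def left_ideal_iff)
      show "a \<oplus> b \<in> I" if bI: "b \<in> I" for b
      proof -
        obtain m' r' where b: "b = m' \<oplus> r' \<otimes> x" "m' \<in> M" "r' \<in> carrier R" "m' \<in> carrier R"
          using bI lM by (auto simp: I_def left_ideal_iff)
        have "a \<oplus> b = (m \<oplus> m') \<oplus> (r \<oplus> r') \<otimes> x" using a b x by (simp add: l_distr a_ac)
        then show ?thesis using I[of "m \<oplus> m'" "r \<oplus> r'"] a b lM by (auto simp: left_ideal_iff)
      qed
      show "y \<otimes> a \<in> I" if "y \<in> carrier R" for y
      proof -
        have "y \<otimes> a = (y \<otimes> m) \<oplus> (y \<otimes> r) \<otimes> x" using a x that by (simp add: r_distr m_assoc)
        then show ?thesis using I[of "y \<otimes> m" "y \<otimes> r"] a that lM by (auto simp: left_ideal_iff)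
      qed
    qed
    moreover have "M \<subseteq> I"
    proof
      fix m assume "m \<in> M"
      then show "m \<in> I" using I[of m \<zero>] x lM by (auto simp: left_ideal_iff)
    qed
    moreover have "x \<in> I" using I[of \<zero> \<one>] x lM by (auto simp: left_ideal_iff)
    ultimately have "I = carrier R" using M \<open>x \<notin> M\<close> by (auto simp: maximal_left_ideal_def)
    then have "\<one> \<in> I" by simp
    then obtain m r where m: "\<one> = m \<oplus> r \<otimes> x" "m \<in> M" "r \<in> carrier R" "m \<in> carrier R"
      using lM by (auto simp: I_def left_ideal_iff)
    have "\<one> \<ominus> r \<otimes> x = m" using m x by (metis a_comm add.inv_solve_right' m_closed minus_eq one_closed)
    then have "m \<in> Units R" using unit_one_minus_nilpotent[OF _ nil[OF m(3)]] m x by auto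
    then have "\<one> \<in> M" using lM m by (metis Units_inv_closed Units_l_inv left_ideal_iff)
    then have "y \<in> M" if "y \<in> carrier R" for y
      using lM that r_one[OF that] unfolding left_ideal_iff by metis
    then show False using lM proper by (auto simp: left_ideal_iff)
  qed
  then show ?thesis using x by (auto simp: jacobson_radical_def)
qed

lemma left_ideal_ideal_prod:
  assumes I: "left_ideal I R" and J: "left_ideal J R"
  shows "left_ideal (ideal_prod R I J) R"
  unfolding left_ideal_iff
proof (intro conjI ballI)
  have I': "I \<subseteq> carrier R" "\<zero> \<in> I" and J': "J \<subseteq> carrier R" "\<zero> \<in> J"
    using I J by (auto simp: left_ideal_iff)
  show c: "ideal_prod R I J \<subseteq> carrier R"
  proof
    fix s assume "s \<in> ideal_prod R I J"
    then show "s \<in> carrier R" using I' J' by induction auto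
  qed
  show "\<zero> \<in> ideal_prod R I J" using ideal_prod.prod[OF I'(2) J'(2), of R] by simp
  fix a assume a: "a \<in> ideal_prod R I J"
  show "a \<oplus> b \<in> ideal_prod R I J" if "b \<in> ideal_prod R I J" for b
    using a that by (rule ideal_prod.sum)
  show "x \<otimes> a \<in> ideal_prod R I J" if x: "x \<in> carrier R" for x
    using a
  proof induction
    case (prod i j)
    then have "x \<otimes> (i \<otimes> j) = (x \<otimes> i) \<otimes> j" using x I' J' by (simp add: m_assoc subset_iff)
    then show ?case using ideal_prod.prod[of "x \<otimes> i" I j J R] prod x I by (simp add: left_ideal_iff)
  next
    case (sum s t)
    then have "s \<in> carrier R" "t \<in> carrier R" using c by auto
    then have "x \<otimes> (s \<oplus> t) = (x \<otimes> s) \<oplus> (x \<otimes> t)" using x by (simp add: r_distr)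
    then show ?case using sum by (simp add: ideal_prod.sum)
  qed
qed

lemma left_ideal_ideal_power: "left_ideal J R \<Longrightarrow> left_ideal (ideal_power R J n) R"
  by (induction n) (auto simp: left_ideal_ideal_prod, auto simp: left_ideal_iff)

lemma ideal_prod_mono_left: "I \<subseteq> K \<Longrightarrow> ideal_prod R I J \<subseteq> ideal_prod R K J"
proof
  fix s assume "I \<subseteq> K" "s \<in> ideal_prod R I J"
  from this(2) show "s \<in> ideal_prod R K J"
    by induction (use \<open>I \<subseteq> K\<close> in \<open>auto intro: ideal_prod.intros\<close>)
qed

lemma ideal_power_antimono:
  assumes J: "left_ideal J R" and "m \<le> n"
  shows "ideal_power R J n \<subseteq> ideal_power R J m"
proof -
  have "ideal_power R J (Suc k) \<subseteq> ideal_power R J k" for k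
  proof (induction k)
    case 0
    show ?case using left_ideal_ideal_power[OF J, of "Suc 0"] by (simp add: left_ideal_iff)
  next
    case (Suc k)
    then show ?case using ideal_prod_mono_left by simp
  qed
  then show ?thesis using assms(2) lift_Suc_antimono_le[of "ideal_power R J"] by blast
qed

text \<open>A form of Nakayama's lemma with a counting argument in place of finite generation. If no power of
\<open>J\<close> vanishes, some elements, among them \<open>\<one>\<close>, are annihilated from the left by no power of \<open>J\<close>.
Choose such an \<open>l\<close> with \<open>R l\<close> of least size. Some \<open>k \<otimes> l\<close> with \<open>k \<in> J\<close> has the same property, so
\<open>R k l = R l\<close> by minimality and \<open>l = r \<otimes> k \<otimes> l\<close> for some \<open>r\<close>. As \<open>\<one> \<ominus> r \<otimes> k\<close> is left invertible,
\<open>l = \<zero>\<close>, a contradiction.\<close>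

lemma ideal_power_jacobson_radical_eq_zero:
  assumes fin: "finite (carrier R)"
  shows "\<exists>n. ideal_power R (jacobson_radical R) n = {\<zero>}"
proof (rule ccontr)
  define J where "J = jacobson_radical R"
  have J: "left_ideal J R" unfolding J_def by (rule left_ideal_jacobson_radical)
  note Jn = left_ideal_ideal_power[OF J, unfolded left_ideal_iff]
  assume no: "\<not> ?thesis"
  define G where "G = {l \<in> carrier R. \<forall>n. \<exists>s \<in> ideal_power R J n. s \<otimes> l \<noteq> \<zero>}"
  define c where "c l = card ((\<lambda>r. r \<otimes> l) ` carrier R)" for l
  have "\<one> \<in> G"
  proof -
    have "\<exists>s \<in> ideal_power R J n. s \<otimes> \<one> \<noteq> \<zero>" for n
    proof -
      have "ideal_power R J n \<noteq> {\<zero>}" using no by (auto simp: J_def)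
      then obtain s where "s \<in> ideal_power R J n" "s \<noteq> \<zero>" using Jn[of n] by blast
      then show ?thesis using Jn[of n] by (intro bexI[of _ s]) auto
    qed
    then show ?thesis by (auto simp: G_def)
  qed
  then obtain l where l: "l \<in> G" and min: "\<And>l'. l' \<in> G \<Longrightarrow> c l \<le> c l'"
    using ex_has_least_nat[of "\<lambda>l. l \<in> G" \<one> c] by blast
  have lc: "l \<in> carrier R" using l by (simp add: G_def)
  have "\<exists>k \<in> J. k \<otimes> l \<in> G"
  proof (rule ccontr)
    assume "\<not> ?thesis"
    then have "\<forall>k \<in> J. \<exists>n. \<forall>s \<in> ideal_power R J n. s \<otimes> (k \<otimes> l) = \<zero>"
      using lc J by (auto simp: G_def left_ideal_iff)
    then obtain N where N: "\<And>k s. k \<in> J \<Longrightarrow> s \<in> ideal_power R J (N k) \<Longrightarrow> s \<otimes> (k \<otimes> l) = \<zero>"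
      by metis
    have finJ: "finite J" using fin J finite_subset by (auto simp: left_ideal_iff)
    \<comment> \<open>Powers of \<open>J\<close> decrease, so one exponent serves every \<open>k \<in> J\<close>, and the next one kills \<open>l\<close>.\<close>
    define m where "m = Max (N ` J)"
    have "s \<otimes> l = \<zero>" if "s \<in> ideal_prod R (ideal_power R J m) J" for s
      using that
    proof induction
      case (prod i k)
      then have "N k \<le> m" using finJ by (simp add: m_def)
      then have "i \<in> ideal_power R J (N k)" using prod ideal_power_antimono[OF J] by blast
      then have "i \<otimes> (k \<otimes> l) = \<zero>" using N prod by blast
      then show ?case using prod lc J Jn[of m] by (auto simp: left_ideal_iff m_assoc subset_iff)
    next
      case (sum s t)
      then have "s \<in> carrier R" "t \<in> carrier R" using Jn[of "Suc m"] by auto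
      then show ?case using sum lc by (simp add: l_distr)
    qed
    moreover have "\<exists>s \<in> ideal_power R J (Suc m). s \<otimes> l \<noteq> \<zero>" using l by (auto simp only: G_def)
    ultimately show False by auto
  qed
  then obtain k where k: "k \<in> J" "k \<otimes> l \<in> G" by blast
  have kc: "k \<in> carrier R" using k J by (auto simp: left_ideal_iff)
  have "(\<lambda>r. r \<otimes> (k \<otimes> l)) ` carrier R \<subseteq> (\<lambda>r. r \<otimes> l) ` carrier R"
    using kc lc by (auto simp: m_assoc[symmetric])
  then have "(\<lambda>r. r \<otimes> (k \<otimes> l)) ` carrier R = (\<lambda>r. r \<otimes> l) ` carrier R"
    using min[OF k(2)] fin by (intro card_seteq) (auto simp: c_def)
  moreover have "l \<in> (\<lambda>r. r \<otimes> l) ` carrier R" using lc by (intro image_eqI[of _ _ \<one>]) auto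
  ultimately obtain r where r: "r \<in> carrier R" "l = r \<otimes> (k \<otimes> l)" by blast
  have "r \<otimes> k \<in> jacobson_radical R" using r k J by (auto simp: left_ideal_iff J_def)
  then obtain u where u: "u \<in> carrier R" "u \<otimes> (\<one> \<ominus> r \<otimes> k) = \<one>"
    using jacobson_radical_left_inverse[OF fin] by blast
  have "(\<one> \<ominus> r \<otimes> k) \<otimes> l = l \<ominus> r \<otimes> (k \<otimes> l)"
    using r(1) kc lc by (simp add: minus_eq l_distr l_minus m_assoc)
  then have "(\<one> \<ominus> r \<otimes> k) \<otimes> l = \<zero>" using r(2) lc by (simp add: r_neg minus_eq)
  then have "u \<otimes> ((\<one> \<ominus> r \<otimes> k) \<otimes> l) = \<zero>" using u(1) by simp
  moreover have "u \<otimes> ((\<one> \<ominus> r \<otimes> k) \<otimes> l) = l"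
    using u r(1) kc lc by (subst m_assoc[symmetric]) auto
  ultimately have "l = \<zero>" by simp
  moreover have "\<exists>s \<in> ideal_power R J 0. s \<otimes> l \<noteq> \<zero>" using l by (auto simp only: G_def)
  ultimately show False by auto
qed

text \<open>Nilpotency of \<open>J\<close> must be known first: \<^const>\<open>nilpotency\<close> is a least number with a property, and
says something about \<open>J\<close> only when such a number exists.\<close>

lemma jacobson_radical_triple_product:
  assumes fin: "finite (carrier R)" and nil: "nilpotency R (jacobson_radical R) \<le> 3"
    and abc: "a \<in> jacobson_radical R" "b \<in> jacobson_radical R" "c \<in> jacobson_radical R"
  shows "a \<otimes> b \<otimes> c = \<zero>"
proof -
  define J where "J = jacobson_radical R"
  have J: "left_ideal J R" unfolding J_def by (rule left_ideal_jacobson_radical)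
  note Jn = left_ideal_ideal_power[OF J, unfolded left_ideal_iff]
  obtain n where n: "ideal_power R J n = {\<zero>}"
    using ideal_power_jacobson_radical_eq_zero[OF fin] by (auto simp: J_def)
  have "0 < Suc n \<and> ideal_power R J (Suc n) = {\<zero>}"
    using n ideal_power_antimono[OF J, of n "Suc n"] Jn[of "Suc n"] by auto
  then have "ideal_power R J (nilpotency R J) = {\<zero>}"
    unfolding nilpotency_def
    using LeastI[of "\<lambda>n. 0 < n \<and> ideal_power R J n = {\<zero>}" "Suc n"] by blast
  then have J3: "ideal_power R J 3 \<subseteq> {\<zero>}"
    using ideal_power_antimono[OF J nil[folded J_def]] by simp
  have abc': "a \<in> J" "b \<in> J" "c \<in> J" using abc by (auto simp: J_def)
  then have "\<one> \<otimes> a \<otimes> b \<otimes> c \<in> ideal_power R J 3"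
    by (auto simp: numeral_3_eq_3 intro!: ideal_prod.prod)
  then show ?thesis using J3 abc' J by (auto simp: left_ideal_iff subset_iff)
qed


section \<open>Peirce components and generation by units and idempotents\<close>

text \<open>For \<open>x\<close> in the Peirce component \<open>eRd\<close>, the product \<open>r \<otimes> x\<close> is nilpotent together with \<open>x \<otimes> (r \<otimes> e)\<close>, which
lies in \<open>eRdRe\<close>. So \<open>R x\<close> is nil as soon as all products of an element of \<open>eRd\<close> with one of \<open>dRe\<close>
are nilpotent, and the same holds for elements of \<open>dRe\<close>.\<close>

lemma nilpotent_peirce_in_jacobson_radical:
  assumes ed: "complementary_idempotents e d"
    and nil: "\<And>x y. x \<in> carrier R \<Longrightarrow> y \<in> carrier R \<Longrightarrow> nilpotent_elem (e \<otimes> x \<otimes> d \<otimes> y \<otimes> e)"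
    and x: "x \<in> carrier R"
  shows "e \<otimes> x \<otimes> d \<in> jacobson_radical R" "d \<otimes> x \<otimes> e \<in> jacobson_radical R"
proof -
  have c: "e \<in> carrier R" "d \<in> carrier R" using ed by (auto simp: complementary_idempotents_def)
  note idem = complementary_idempotents_idem[OF ed]
  have ee: "e \<otimes> (e \<otimes> z) = e \<otimes> z" "d \<otimes> (d \<otimes> z) = d \<otimes> z" if "z \<in> carrier R" for z
    using that c idem by (simp_all add: m_assoc[symmetric])
  show "e \<otimes> x \<otimes> d \<in> jacobson_radical R"
  proof (rule nil_left_ideal_in_jacobson_radical)
    fix r assume r: "r \<in> carrier R"
    show "nilpotent_elem (r \<otimes> (e \<otimes> x \<otimes> d))"
      by (rule nilpotent_elem_sandwich[OF c(1) r]) (use nil[OF x r] c x r ee in \<open>simp_all add: m_assoc\<close>)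
  qed (use x c in auto)
  show "d \<otimes> x \<otimes> e \<in> jacobson_radical R"
  proof (rule nil_left_ideal_in_jacobson_radical)
    fix r assume r: "r \<in> carrier R"
    have "nilpotent_elem ((e \<otimes> r \<otimes> d) \<otimes> (d \<otimes> x \<otimes> e))"
      using nil[OF r x] c x r ee by (simp add: m_assoc)
    then have "nilpotent_elem ((d \<otimes> x \<otimes> e) \<otimes> (e \<otimes> r \<otimes> d))"
      using c x r by (intro nilpotent_elem_swap[of "e \<otimes> r \<otimes> d"]) auto
    then show "nilpotent_elem (r \<otimes> (d \<otimes> x \<otimes> e))"
      by (intro nilpotent_elem_sandwich[OF c(2) r]) (use c x r ee in \<open>simp_all add: m_assoc\<close>)
  qed (use x c in auto)
qed

text \<open>An element \<open>r\<close> with idempotent power \<open>e\<close> splits as \<open>r \<otimes> e \<oplus> r \<otimes> d\<close> with \<open>d = \<one> \<ominus> e\<close> (Fitting): here \<open>r \<otimes> e\<close> is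
invertible in \<open>eRe\<close>, so \<open>r \<otimes> e \<oplus> d\<close> is a unit, and \<open>r \<otimes> d\<close> is nilpotent, so \<open>\<one> \<ominus> r \<otimes> d\<close> is a unit.
Hence units and idempotents generate the ring, and only idempotents need attention.

The components \<open>eRd\<close> and \<open>dRe\<close> of an idempotent consist of elements of square zero, so they are in
\<open>T\<close>. If some \<open>w \<in> eRd \<cdot> dRe\<close> is not nilpotent, its idempotent power \<open>g\<close> is nonzero and in \<open>T\<close>, and
\<open>e \<ominus> g\<close> is an idempotent generating a smaller left ideal. Splitting off such \<open>g\<close> repeatedly ends
at idempotents for which every such product is nilpotent. This takes the place of the
Artin-Wedderburn theorem: these final idempotents are central modulo the radical.\<close>

lemma generated_by_units_and_idempotents_with_nil_corner:
  assumes fin: "finite (carrier R)"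
    and T: "T \<subseteq> carrier R" "\<And>x y. x \<in> T \<Longrightarrow> y \<in> T \<Longrightarrow> x \<oplus> y \<in> T"
      "\<And>x. x \<in> T \<Longrightarrow> \<ominus> x \<in> T" "\<And>x y. x \<in> T \<Longrightarrow> y \<in> T \<Longrightarrow> x \<otimes> y \<in> T"
      "Units R \<subseteq> T"
    and idem: "\<And>e d. complementary_idempotents e d \<Longrightarrow>
      (\<And>x y. x \<in> carrier R \<Longrightarrow> y \<in> carrier R \<Longrightarrow> nilpotent_elem (e \<otimes> x \<otimes> d \<otimes> y \<otimes> e)) \<Longrightarrow> e \<in> T"
    and r: "r \<in> carrier R"
  shows "r \<in> T"
proof -
  have oneT: "\<one> \<in> T" using T(5) by auto
  have minusT: "x \<ominus> y \<in> T" if "x \<in> T" "y \<in> T" for x y using that T by (simp add: minus_eq)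
  have powT: "x [^] n \<in> T" if "x \<in> T" for x and n :: nat
    using that by (induction n) (auto simp: oneT T(4))
  have nilT: "x \<in> T" if "x \<in> carrier R" "nilpotent_elem x" for x
  proof -
    have "\<one> \<ominus> x \<in> T" using unit_one_minus_nilpotent[OF that] T(5) by blast
    then have "\<one> \<ominus> (\<one> \<ominus> x) \<in> T" using oneT minusT by blast
    moreover have "\<one> \<ominus> (\<one> \<ominus> x) = x"
      using that by (simp add: minus_eq minus_add a_assoc[symmetric] r_neg)
    ultimately show ?thesis by simp
  qed
  have peirceT: "e \<otimes> x \<otimes> d \<in> T" if "complementary_idempotents e d" "x \<in> carrier R" for e d x
  proof (rule nilT)
    have c: "e \<in> carrier R" "d \<in> carrier R" "d \<otimes> e = \<zero>"
      using that by (auto simp: complementary_idempotents_def)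
    have "(e \<otimes> x \<otimes> d) [^] (2::nat) = e \<otimes> x \<otimes> (d \<otimes> e) \<otimes> x \<otimes> d"
      using that c(1,2) by (simp add: numeral_2_eq_2 m_assoc)
    then have "(e \<otimes> x \<otimes> d) [^] (2::nat) = \<zero>" using c that by simp
    then show "nilpotent_elem (e \<otimes> x \<otimes> d)" unfolding nilpotent_elem_def by blast
    show "e \<otimes> x \<otimes> d \<in> carrier R" using c that by simp
  qed
  have idemT: "e \<in> T" if "e \<in> carrier R" "e \<otimes> e = e" for e
    using that
  proof (induction "card ((\<lambda>r. r \<otimes> e) ` carrier R)" arbitrary: e rule: less_induct)
    case less
    define d where "d = \<one> \<ominus> e"
    have ed: "complementary_idempotents e d"
      unfolding d_def using less.prems by (rule complementary_idempotents_one_minus)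
    have c: "e \<in> carrier R" "d \<in> carrier R" using ed by (auto simp: complementary_idempotents_def)
    note i2 = complementary_idempotents_idem[OF ed]
    show "e \<in> T"
    proof (cases "\<forall>x \<in> carrier R. \<forall>y \<in> carrier R. nilpotent_elem (e \<otimes> x \<otimes> d \<otimes> y \<otimes> e)")
      case True
      then show ?thesis using idem[OF ed] by blast
    next
      case False
      then obtain x y where xy: "x \<in> carrier R" "y \<in> carrier R"
        and not_nil: "\<not> nilpotent_elem (e \<otimes> x \<otimes> d \<otimes> y \<otimes> e)" by blast
      define w where "w = e \<otimes> x \<otimes> d \<otimes> y \<otimes> e"
      have w: "w \<in> carrier R" "e \<otimes> w = w" "w \<otimes> e = w"
        using xy c i2 by (simp_all add: w_def m_assoc) (simp_all add: m_assoc[symmetric] i2)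
      have "w = (e \<otimes> x \<otimes> d) \<otimes> (d \<otimes> y \<otimes> e)"
      proof -
        have "(e \<otimes> x \<otimes> d) \<otimes> (d \<otimes> y \<otimes> e) = e \<otimes> x \<otimes> (d \<otimes> d) \<otimes> y \<otimes> e"
          using xy c by (simp add: m_assoc)
        then show ?thesis by (simp add: w_def i2)
      qed
      then have wT: "w \<in> T"
        using peirceT[OF ed xy(1)] peirceT[OF complementary_idempotents_sym[OF ed] xy(2)] T(4) by simp
      obtain n :: nat where n: "0 < n" "w [^] n \<otimes> w [^] n = w [^] n"
        using idempotent_power[OF fin w(1)] by blast
      define g where "g = w [^] n"
      obtain m where m: "n = Suc m" using n(1) gr0_implies_Suc by blast
      have g: "g \<in> carrier R" "g \<in> T" "g \<noteq> \<zero>" "g \<otimes> g = g"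
        using w(1) wT powT n(2) not_nil by (auto simp: g_def nilpotent_elem_def w_def[symmetric])
      have ge: "g \<otimes> e = g" using w c by (simp add: g_def m m_assoc)
      have "g = w \<otimes> w [^] m" using w(1) by (simp only: g_def m nat_pow_Suc2)
      then have eg: "e \<otimes> g = g" using w c by (simp add: m_assoc[symmetric])
      \<comment> \<open>The rest of \<open>e\<close> is orthogonal to \<open>g\<close>. Since \<open>e \<otimes> g = g\<close> is nonzero, \<open>R h\<close> misses \<open>e\<close>.\<close>
      define h where "h = e \<ominus> g"
      have h: "h \<in> carrier R" using c g by (simp add: h_def)
      have hh: "h \<otimes> h = h" "h \<otimes> g = \<zero>" "h \<otimes> e = h"
        using c g ge eg i2 by (simp_all add: h_def minus_eq l_distr r_distr l_minus r_minus r_neg a_assoc)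
      have sub: "(\<lambda>r. r \<otimes> h) ` carrier R \<subseteq> (\<lambda>r. r \<otimes> e) ` carrier R"
      proof
        fix z assume "z \<in> (\<lambda>r. r \<otimes> h) ` carrier R"
        then obtain r where "r \<in> carrier R" "z = r \<otimes> h" by blast
        then show "z \<in> (\<lambda>r. r \<otimes> e) ` carrier R"
          using h c hh by (intro image_eqI[of _ _ "r \<otimes> h"]) (auto simp: m_assoc)
      qed
      have "e \<notin> (\<lambda>r. r \<otimes> h) ` carrier R"
      proof
        assume "e \<in> (\<lambda>r. r \<otimes> h) ` carrier R"
        then obtain r where "r \<in> carrier R" "e = r \<otimes> h" by blast
        then have "e \<otimes> g = \<zero>" using h g hh by (simp add: m_assoc)
        then show False using eg g by simp
      qed
      moreover have "e \<in> (\<lambda>r. r \<otimes> e) ` carrier R" using c by (intro image_eqI[of _ _ \<one>]) auto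
      ultimately have "card ((\<lambda>r. r \<otimes> h) ` carrier R) < card ((\<lambda>r. r \<otimes> e) ` carrier R)"
        using sub fin by (intro psubset_card_mono) auto
      then have "h \<in> T" using less.hyps h hh by blast
      moreover have "e = h \<oplus> g" using c g by (simp add: h_def minus_eq a_assoc l_neg)
      ultimately show ?thesis using g T(2) by metis
    qed
  qed
  obtain n :: nat where n: "0 < n" "r [^] n \<otimes> r [^] n = r [^] n"
    using idempotent_power[OF fin r] by blast
  obtain m where m: "n = Suc m" using n(1) gr0_implies_Suc by blast
  define e where "e = r [^] n"
  define d where "d = \<one> \<ominus> e"
  have ec: "e \<in> carrier R" "e \<otimes> e = e" using r n by (auto simp: e_def)
  then have ed: "complementary_idempotents e d"
    unfolding d_def by (rule complementary_idempotents_one_minus)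
  then have c: "d \<in> carrier R" "e \<otimes> d = \<zero>" "d \<otimes> e = \<zero>" "e \<oplus> d = \<one>"
    by (auto simp: complementary_idempotents_def)
  note i2 = complementary_idempotents_idem[OF ed]
  have pe: "e \<otimes> r [^] k = r [^] k \<otimes> e" for k :: nat
    using r by (simp add: e_def nat_pow_mult add.commute)
  have re: "e \<otimes> r = r \<otimes> e" using pe[of 1] r by simp
  have rd: "d \<otimes> r = r \<otimes> d"
    using re r ec by (simp add: d_def minus_eq l_distr r_distr l_minus r_minus)
  have dT: "d \<in> T" using idemT c i2 by blast
  define s where "s = r [^] m"
  have s: "s \<in> carrier R" "e \<otimes> s = s \<otimes> e" "r \<otimes> s = e" "s \<otimes> r = e"
    using r pe nat_pow_Suc2[OF r, of m] by (simp_all add: s_def e_def m)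
  have "(x \<otimes> e \<oplus> d) \<otimes> (y \<otimes> e \<oplus> d) = \<one>"
    if xy: "x \<in> carrier R" "y \<in> carrier R" "e \<otimes> y = y \<otimes> e" "x \<otimes> y = e" for x y
  proof -
    have "(x \<otimes> e) \<otimes> (y \<otimes> e) = x \<otimes> (e \<otimes> y) \<otimes> e" using xy(1,2) ec by (simp add: m_assoc)
    also have "\<dots> = (x \<otimes> y) \<otimes> (e \<otimes> e)" using xy(1-3) ec(1) by (simp add: m_assoc)
    also have "\<dots> = e" using xy(4) ec by simp
    finally have 1: "(x \<otimes> e) \<otimes> (y \<otimes> e) = e" .
    have "d \<otimes> (y \<otimes> e) = (d \<otimes> e) \<otimes> y" using xy(1-3) ec(1) c(1) by (simp add: m_assoc)
    then have 2: "d \<otimes> (y \<otimes> e) = \<zero>" using xy c by simp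
    have 3: "(x \<otimes> e) \<otimes> d = \<zero>" using xy ec c by (simp add: m_assoc)
    show ?thesis using xy(1,2) ec(1) c i2 by (simp add: l_distr r_distr 1 2 3)
  qed
  from this[OF r s(1,2,3)] this[OF s(1) r re s(4)]
  have "(r \<otimes> e \<oplus> d) \<otimes> (s \<otimes> e \<oplus> d) = \<one>" "(s \<otimes> e \<oplus> d) \<otimes> (r \<otimes> e \<oplus> d) = \<one>" .
  then have "r \<otimes> e \<oplus> d \<in> Units R" using r ec c s by (auto simp: Units_def)
  then have "(r \<otimes> e \<oplus> d) \<ominus> d \<in> T" using T(5) dT minusT by blast
  then have reT: "r \<otimes> e \<in> T" using r ec c by (simp add: minus_eq a_assoc r_neg)
  have "(r \<otimes> d) [^] k \<otimes> d = r [^] k \<otimes> d" for k :: nat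
  proof (induction k)
    case (Suc k)
    have "(r \<otimes> d) [^] Suc k \<otimes> d = (r \<otimes> d) [^] k \<otimes> (r \<otimes> (d \<otimes> d))"
      using r c by (simp add: m_assoc)
    also have "\<dots> = (r \<otimes> d) [^] k \<otimes> d \<otimes> r" using r c i2 by (simp add: m_assoc rd)
    also have "\<dots> = r [^] k \<otimes> d \<otimes> r" by (simp only: Suc)
    also have "\<dots> = r [^] Suc k \<otimes> d" using r c by (simp add: m_assoc rd)
    finally show ?case .
  qed (use c in auto)
  from this[of n] have "(r \<otimes> d) [^] n \<otimes> d = \<zero>" using c by (simp add: e_def[symmetric])
  moreover have "(r \<otimes> d) [^] n \<otimes> d = (r \<otimes> d) [^] n"
    using r c i2 by (simp add: m m_assoc)
  ultimately have "nilpotent_elem (r \<otimes> d)" unfolding nilpotent_elem_def by metis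
  then have "r \<otimes> d \<in> T" using nilT r c by simp
  then have "r \<otimes> e \<oplus> r \<otimes> d \<in> T" using reT T(2) by blast
  then show "r \<in> T" using r ec c by (simp add: r_distr[symmetric])
qed

text \<open>For \<open>v = e a e + d a d\<close> and \<open>u = v + e a d\<close>, in block matrices \<open>v\<close> is the diagonal and \<open>u\<close> the upper triangular part of
\<open>a\<close>. The \<open>(e, d)\<close> block of \<open>a\<^sup>n\<close> is a sum over block paths from \<open>e\<close> to \<open>d\<close>, and the hypothesis
kills the paths that switch sides three times or more. A path from \<open>e\<close> to \<open>d\<close> switches an odd number
of times, so only the paths with one switch remain, and these are the ones that \<open>u\<close> provides.
The \<open>d\<close> column of \<open>u\<^sup>n\<close> has, besides, the diagonal block of \<open>v\<^sup>n\<close>.\<close>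

lemma off_diagonal_block_of_power:
  assumes ed: "complementary_idempotents e d" and a: "a \<in> carrier R"
    and triple: "\<And>x y z. x \<in> carrier R \<Longrightarrow> y \<in> carrier R \<Longrightarrow> z \<in> carrier R \<Longrightarrow>
      e \<otimes> x \<otimes> d \<otimes> y \<otimes> e \<otimes> z \<otimes> d = \<zero>"
  shows "(e \<otimes> a \<otimes> e \<oplus> e \<otimes> a \<otimes> d \<oplus> d \<otimes> a \<otimes> d) [^] (n::nat) \<otimes> d =
    e \<otimes> a [^] n \<otimes> d \<oplus> (e \<otimes> a \<otimes> e \<oplus> d \<otimes> a \<otimes> d) [^] n \<otimes> d"
proof -
  have c: "e \<in> carrier R" "d \<in> carrier R" "e \<otimes> d = \<zero>" "d \<otimes> e = \<zero>" "e \<oplus> d = \<one>"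
    using ed by (auto simp: complementary_idempotents_def)
  note i2 = complementary_idempotents_idem[OF ed]
  have absorb: "e \<otimes> (e \<otimes> z) = e \<otimes> z" "d \<otimes> (d \<otimes> z) = d \<otimes> z"
    "e \<otimes> (d \<otimes> z) = \<zero>" "d \<otimes> (e \<otimes> z) = \<zero>" if "z \<in> carrier R" for z
    using that c i2 by (simp_all add: m_assoc[symmetric])
  have split: "z = e \<otimes> z \<oplus> d \<otimes> z" if "z \<in> carrier R" for z
    using that c by (simp add: l_distr[symmetric])
  define u where "u = e \<otimes> a \<otimes> e \<oplus> e \<otimes> a \<otimes> d \<oplus> d \<otimes> a \<otimes> d"
  define v where "v = e \<otimes> a \<otimes> e \<oplus> d \<otimes> a \<otimes> d"
  have uv: "u \<in> carrier R" "v \<in> carrier R" using a c by (auto simp: u_def v_def)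
  have va: "v \<otimes> (e \<otimes> x \<otimes> d) = e \<otimes> (a \<otimes> e \<otimes> x) \<otimes> d"
    and ua: "u \<otimes> (e \<otimes> x \<otimes> d) = e \<otimes> (a \<otimes> e \<otimes> x) \<otimes> d" if "x \<in> carrier R" for x
    using that a c i2 absorb by (simp_all add: u_def v_def l_distr m_assoc)
  \<comment> \<open>In front of \<open>eRd\<close>, an excursion of a power of \<open>a\<close> to the side \<open>d\<close> and back is invisible.\<close>
  have v_pow: "v [^] k \<otimes> (e \<otimes> x \<otimes> d) = e \<otimes> a [^] k \<otimes> (e \<otimes> x \<otimes> d)" if "x \<in> carrier R" for k :: nat and x
    using that
  proof (induction k arbitrary: x)
    case (Suc k)
    let ?y = "a \<otimes> e \<otimes> x"
    have "e \<otimes> a [^] Suc k \<otimes> (e \<otimes> x \<otimes> d) = e \<otimes> a [^] k \<otimes> (?y \<otimes> d)"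
      using Suc.prems a c by (simp add: m_assoc)
    also have "?y \<otimes> d = e \<otimes> ?y \<otimes> d \<oplus> d \<otimes> ?y \<otimes> d"
      using split[of "?y \<otimes> d"] Suc.prems a c by (simp add: m_assoc)
    also have "e \<otimes> a [^] k \<otimes> \<dots> = e \<otimes> a [^] k \<otimes> (e \<otimes> ?y \<otimes> d) \<oplus> e \<otimes> a [^] k \<otimes> d \<otimes> a \<otimes> e \<otimes> x \<otimes> d"
      using Suc.prems a c by (simp add: m_assoc r_distr)
    also have "e \<otimes> a [^] k \<otimes> d \<otimes> a \<otimes> e \<otimes> x \<otimes> d = \<zero>" using triple Suc.prems a by simp
    also have "e \<otimes> a [^] k \<otimes> (e \<otimes> ?y \<otimes> d) = v [^] k \<otimes> (e \<otimes> ?y \<otimes> d)"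
      using Suc.IH[of ?y] Suc.prems a c by simp
    also have "\<dots> = v [^] k \<otimes> (v \<otimes> (e \<otimes> x \<otimes> d))" using va Suc.prems by simp
    finally show ?case using uv a c Suc.prems by (simp add: m_assoc)
  qed (use c absorb in \<open>simp add: m_assoc\<close>)
  have u_pow: "u [^] k \<otimes> (e \<otimes> x \<otimes> d) = v [^] k \<otimes> (e \<otimes> x \<otimes> d)" if "x \<in> carrier R" for k :: nat and x
    using that
  proof (induction k arbitrary: x)
    case (Suc k)
    have "u [^] Suc k \<otimes> (e \<otimes> x \<otimes> d) = u [^] k \<otimes> (u \<otimes> (e \<otimes> x \<otimes> d))"
      using Suc.prems uv c by (simp add: m_assoc)
    also have "\<dots> = v [^] k \<otimes> (v \<otimes> (e \<otimes> x \<otimes> d))" using Suc a c by (simp add: va ua)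
    finally show ?case using Suc.prems uv c by (simp add: m_assoc)
  qed (use c in simp)
  have "u [^] n \<otimes> d = e \<otimes> a [^] n \<otimes> d \<oplus> v [^] n \<otimes> d"
  proof (induction n)
    case (Suc n)
    have "u \<otimes> d = e \<otimes> a \<otimes> d \<oplus> d \<otimes> a \<otimes> d" "v \<otimes> d = d \<otimes> a \<otimes> d"
      using a c i2 by (simp_all add: u_def v_def l_distr m_assoc)
    then have ud: "u \<otimes> d = e \<otimes> a \<otimes> d \<oplus> d \<otimes> (a \<otimes> d)" and vd: "v \<otimes> d = d \<otimes> (a \<otimes> d)"
      using a c by (simp_all add: m_assoc)
    have "u [^] Suc n \<otimes> d = u [^] n \<otimes> (u \<otimes> d)" using uv c by (simp add: m_assoc)
    also have "\<dots> = u [^] n \<otimes> (e \<otimes> a \<otimes> d) \<oplus> u [^] n \<otimes> d \<otimes> (a \<otimes> d)"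
      unfolding ud using uv a c by (simp add: r_distr m_assoc)
    also have "u [^] n \<otimes> d = e \<otimes> a [^] n \<otimes> d \<oplus> v [^] n \<otimes> d" by (rule Suc)
    also have "u [^] n \<otimes> (e \<otimes> a \<otimes> d) = e \<otimes> a [^] n \<otimes> (e \<otimes> a \<otimes> d)" using a u_pow v_pow by simp
    also have "e \<otimes> a [^] n \<otimes> (e \<otimes> a \<otimes> d) \<oplus> (e \<otimes> a [^] n \<otimes> d \<oplus> v [^] n \<otimes> d) \<otimes> (a \<otimes> d)
      = e \<otimes> a [^] n \<otimes> (e \<otimes> (a \<otimes> d) \<oplus> d \<otimes> (a \<otimes> d)) \<oplus> v [^] n \<otimes> (d \<otimes> (a \<otimes> d))"
      using uv a c by (simp add: l_distr r_distr m_assoc a_assoc)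
    also have "e \<otimes> (a \<otimes> d) \<oplus> d \<otimes> (a \<otimes> d) = a \<otimes> d" using split[of "a \<otimes> d"] a c by simp
    also have "d \<otimes> (a \<otimes> d) = v \<otimes> d" by (simp only: vd)
    finally show ?case using uv a c by (simp add: m_assoc)
  qed (use c in simp)
  then show ?thesis by (simp only: u_def v_def)
qed

end

section \<open>Replacing the powers of the indeterminate\<close>

context UP_ring
begin

text \<open>Evaluation at \<open>a\<close> with the powers \<open>a\<^sup>i\<close> replaced by an arbitrary sequence. In contrast to
evaluation, this is additive in the sequence as well, so identities between powers of different
elements turn into identities between values.\<close>

definition coeff_pairing :: "(nat \<Rightarrow> 'a) \<Rightarrow> (nat \<Rightarrow> 'a) \<Rightarrow> 'a" where
  "coeff_pairing f s = (\<Oplus>i \<in> {..deg R f}. coeff P f i \<otimes> s i)"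

lemma null_ideal_iff:
  "f \<in> null_ideal R \<longleftrightarrow>
     f \<in> carrier P \<and> (\<forall>a \<in> carrier R. coeff_pairing f (\<lambda>i. a [^] i) = \<zero>)"
  by (auto simp: null_ideal_def coeff_pairing_def P_def[symmetric] eval_on_carrier)

lemma poly_induct [consumes 1, case_names monom add]:
  assumes p: "p \<in> carrier P"
    and monom: "\<And>c n. c \<in> carrier R \<Longrightarrow> Q (monom P c n)"
    and add: "\<And>p q. p \<in> carrier P \<Longrightarrow> q \<in> carrier P \<Longrightarrow> Q p \<Longrightarrow> Q q \<Longrightarrow> Q (p \<oplus>\<^bsub>P\<^esub> q)"
  shows "Q p"
proof -
  have "Q (\<Oplus>\<^bsub>P\<^esub> i \<in> {..n}. monom P (coeff P p i) i)" for n
  proof (induction n)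
    case (Suc n)
    then show ?case using p by (subst P.finsum_Suc) (auto intro!: add monom P.finsum_closed)
  qed (use p monom in auto)
  then show ?thesis using up_repr[OF p] by metis
qed

context
  fixes s :: "nat \<Rightarrow> 'a"
  assumes s: "\<And>i. s i \<in> carrier R"
begin

lemma coeff_pairing_closed [simp]: "f \<in> carrier P \<Longrightarrow> coeff_pairing f s \<in> carrier R"
  using s by (auto simp: coeff_pairing_def intro!: R.finsum_closed)

lemma coeff_pairing_bound:
  assumes "f \<in> carrier P" "deg R f \<le> n"
  shows "coeff_pairing f s = (\<Oplus>i \<in> {..n}. coeff P f i \<otimes> s i)"
  unfolding coeff_pairing_def
  by (rule R.add.finprod_mono_neutral_cong_left) (use assms s in \<open>auto simp: deg_aboveD\<close>)

lemma coeff_pairing_add_poly: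
  assumes "f \<in> carrier P" "g \<in> carrier P"
  shows "coeff_pairing (f \<oplus>\<^bsub>P\<^esub> g) s = coeff_pairing f s \<oplus> coeff_pairing g s"
proof -
  define n where "n = max (deg R f) (deg R g)"
  have "deg R f \<le> n" "deg R g \<le> n" "deg R (f \<oplus>\<^bsub>P\<^esub> g) \<le> n"
    using assms by (auto simp: n_def)
  then show ?thesis using assms s
    by (simp add: coeff_pairing_bound R.l_distr R.finsum_addf Pi_def)
qed

lemma coeff_pairing_monom:
  assumes c: "c \<in> carrier R"
  shows "coeff_pairing (monom P c n) s = c \<otimes> s n"
proof -
  have "coeff_pairing (monom P c n) s = (\<Oplus>i \<in> {..n}. if n = i then c \<otimes> s i else \<zero>)"
    unfolding coeff_pairing_bound[OF monom_closed[OF c] deg_monom_le[OF c]]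
    using c s by (intro R.finsum_cong') auto
  also have "\<dots> = c \<otimes> s n"
    using c s by (subst R.add.finprod_singleton) auto
  finally show ?thesis .
qed

lemma coeff_pairing_mult_const:
  assumes "f \<in> carrier P" "r \<in> carrier R"
  shows "coeff_pairing f (\<lambda>i. s i \<otimes> r) = coeff_pairing f s \<otimes> r"
  unfolding coeff_pairing_def using assms s
  by (simp add: R.finsum_ldistr R.m_assoc Pi_def)

end

lemma coeff_pairing_add:
  assumes "f \<in> carrier P" "\<And>i. s i \<in> carrier R" "\<And>i. t i \<in> carrier R"
  shows "coeff_pairing f (\<lambda>i. s i \<oplus> t i) = coeff_pairing f s \<oplus> coeff_pairing f t"
  unfolding coeff_pairing_def using assms by (simp add: R.r_distr R.finsum_addf Pi_def)

lemma coeff_pairing_monom_mult: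
  assumes s: "\<And>i. s i \<in> carrier R" and f: "f \<in> carrier P" and c: "c \<in> carrier R"
  shows "coeff_pairing (monom P c n \<otimes>\<^bsub>P\<^esub> f) s = c \<otimes> coeff_pairing f (\<lambda>i. s (n + i))"
  using f
proof (induction rule: poly_induct)
  case (monom b m)
  then show ?case using s c
    by (simp add: monom_mult[symmetric] coeff_pairing_monom R.m_assoc del: monom_mult)
next
  case (add p q)
  then show ?case using s c by (simp add: P.r_distr coeff_pairing_add_poly R.r_distr)
qed

lemma coeff_pairing_mult_monom:
  assumes s: "\<And>i. s i \<in> carrier R" and f: "f \<in> carrier P" and c: "c \<in> carrier R"
  shows "coeff_pairing (f \<otimes>\<^bsub>P\<^esub> monom P c n) s = coeff_pairing f (\<lambda>i. c \<otimes> s (i + n))"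
  using f
proof (induction rule: poly_induct)
  case (monom b m)
  then show ?case using s c
    by (simp add: monom_mult[symmetric] coeff_pairing_monom R.m_assoc del: monom_mult)
next
  case (add p q)
  then show ?case using s c by (simp add: P.l_distr coeff_pairing_add_poly)
qed

section \<open>Right multipliers of the null ideal\<close>

lemma null_ideal_closed: "f \<in> null_ideal R \<Longrightarrow> f \<in> carrier P"
  by (simp add: null_ideal_iff)

text \<open>The vanishing of \<open>f(a) c\<close>, in the form that applies to sums of such sequences.\<close>

lemma null_ideal_pairing_pow:
  assumes "f \<in> null_ideal R" "a \<in> carrier R" "c \<in> carrier R"
  shows "coeff_pairing f (\<lambda>i. a [^] i \<otimes> c) = \<zero>"
  using assms by (simp add: null_ideal_iff coeff_pairing_mult_const)

lemma null_ideal_add: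
  "f \<in> null_ideal R \<Longrightarrow> g \<in> null_ideal R \<Longrightarrow> f \<oplus>\<^bsub>P\<^esub> g \<in> null_ideal R"
  by (simp add: null_ideal_iff coeff_pairing_add_poly)

lemma null_ideal_zero: "\<zero>\<^bsub>P\<^esub> \<in> null_ideal R"
  by (auto simp: null_ideal_iff coeff_pairing_def R.finsum_zero)

text \<open>Coefficients on the left factor out, and \<open>f\<close> paired with the shifted powers \<open>a\<^sup>n\<^sup>+\<^sup>i\<close> is \<open>f(a) a\<^sup>n\<close>.\<close>

lemma null_ideal_left_mult:
  assumes p: "p \<in> carrier P" and f: "f \<in> null_ideal R"
  shows "p \<otimes>\<^bsub>P\<^esub> f \<in> null_ideal R"
  using p
proof (induction rule: poly_induct)
  case (monom c n)
  have "coeff_pairing f (\<lambda>i. a [^] (n + i)) = \<zero>" if "a \<in> carrier R" for a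
    using null_ideal_pairing_pow[OF f that, of "a [^] n"] that
    by (simp add: R.nat_pow_mult add.commute)
  then show ?case using monom f by (simp add: null_ideal_iff coeff_pairing_monom_mult)
next
  case (add p q)
  then show ?case using f by (simp add: P.l_distr null_ideal_add null_ideal_closed)
qed

lemma null_ideal_uminus:
  assumes f: "f \<in> null_ideal R"
  shows "\<ominus>\<^bsub>P\<^esub> f \<in> null_ideal R"
proof -
  have "\<ominus>\<^bsub>P\<^esub> f = (\<ominus>\<^bsub>P\<^esub> \<one>\<^bsub>P\<^esub>) \<otimes>\<^bsub>P\<^esub> f" using null_ideal_closed[OF f] by (simp add: P.l_minus)
  then show ?thesis using null_ideal_left_mult[OF _ f] by simp
qed

definition null_ideal_multipliers :: "'a set" where
  "null_ideal_multipliers =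
     {r \<in> carrier R. \<forall>f \<in> null_ideal R. f \<otimes>\<^bsub>P\<^esub> monom P r 0 \<in> null_ideal R}"

lemma null_ideal_multipliers_iff:
  "r \<in> null_ideal_multipliers \<longleftrightarrow> r \<in> carrier R \<and>
     (\<forall>f \<in> null_ideal R. \<forall>a \<in> carrier R. coeff_pairing f (\<lambda>i. r \<otimes> a [^] i) = \<zero>)"
  by (auto simp: null_ideal_multipliers_def null_ideal_iff coeff_pairing_mult_monom)

lemma null_ideal_multipliers_add:
  "r \<in> null_ideal_multipliers \<Longrightarrow> r' \<in> null_ideal_multipliers \<Longrightarrow> r \<oplus> r' \<in> null_ideal_multipliers"
  by (simp add: null_ideal_multipliers_def P.r_distr null_ideal_closed null_ideal_add)

lemma null_ideal_multipliers_uminus: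
  "r \<in> null_ideal_multipliers \<Longrightarrow> \<ominus> r \<in> null_ideal_multipliers"
  by (simp add: null_ideal_multipliers_def P.r_minus null_ideal_closed null_ideal_uminus)

lemma null_ideal_multipliers_mult:
  assumes "r \<in> null_ideal_multipliers" "r' \<in> null_ideal_multipliers"
  shows "r \<otimes> r' \<in> null_ideal_multipliers"
proof -
  have "f \<otimes>\<^bsub>P\<^esub> monom P (r \<otimes> r') 0 = f \<otimes>\<^bsub>P\<^esub> monom P r 0 \<otimes>\<^bsub>P\<^esub> monom P r' 0"
    if "f \<in> null_ideal R" for f
    using assms that monom_mult[of r r' 0 0]
    by (simp add: null_ideal_multipliers_def null_ideal_closed P.m_assoc)
  then show ?thesis using assms by (simp add: null_ideal_multipliers_def)
qed

text \<open>For a unit \<open>u\<close>, \<open>u a\<^sup>i = (u a u\<^sup>-\<^sup>1)\<^sup>i u\<close>, so \<open>(f u)(a) = f(u a u\<^sup>-\<^sup>1) u\<close>.\<close>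

lemma Units_subset_null_ideal_multipliers: "Units R \<subseteq> null_ideal_multipliers"
proof
  fix u assume u: "u \<in> Units R"
  have uc: "u \<in> carrier R" "inv u \<in> carrier R" "inv u \<otimes> u = \<one>" using u by auto
  have "coeff_pairing f (\<lambda>i. u \<otimes> a [^] i) = \<zero>" if f: "f \<in> null_ideal R" and a: "a \<in> carrier R" for f a
  proof -
    have "(u \<otimes> a \<otimes> inv u) [^] i \<otimes> u = u \<otimes> a [^] i" for i :: nat
    proof (induction i)
      case (Suc i)
      have "(u \<otimes> a \<otimes> inv u) [^] Suc i \<otimes> u = (u \<otimes> a \<otimes> inv u) [^] i \<otimes> u \<otimes> a"
        using uc a by (simp add: R.m_assoc)
      also have "\<dots> = u \<otimes> a [^] i \<otimes> a" by (simp only: Suc)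
      finally show ?case using uc a by (simp add: R.m_assoc)
    qed (use uc in auto)
    then show ?thesis
      using null_ideal_pairing_pow[OF f, of "u \<otimes> a \<otimes> inv u" u] uc a by simp
  qed
  then show "u \<in> null_ideal_multipliers" using uc by (simp add: null_ideal_multipliers_iff)
qed

text \<open>The sequence \<open>e a\<^sup>i\<close> is a combination of sequences \<open>b\<^sup>i c\<close>, on all of which \<open>f\<close> vanishes. In blocks,
with \<open>u\<close>, \<open>l\<close> and \<open>v\<close> the upper triangular, lower triangular and diagonal part of \<open>a\<close>: the \<open>(e, d)\<close> block of
\<open>a\<^sup>i\<close> is \<open>u\<^sup>i d - v\<^sup>i d\<close>, and the \<open>(e, e)\<close> block is the column \<open>a\<^sup>i e\<close> without its \<open>(d, e)\<close> block, which is
\<open>l\<^sup>i e - v\<^sup>i e\<close>. The identity \<open>key\<close> below says this without subtraction.\<close>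

lemma idempotent_null_ideal_multiplier:
  assumes ed: "R.complementary_idempotents e d"
    and ede: "\<And>x y z. x \<in> carrier R \<Longrightarrow> y \<in> carrier R \<Longrightarrow> z \<in> carrier R \<Longrightarrow>
      e \<otimes> x \<otimes> d \<otimes> y \<otimes> e \<otimes> z \<otimes> d = \<zero>"
    and ded: "\<And>x y z. x \<in> carrier R \<Longrightarrow> y \<in> carrier R \<Longrightarrow> z \<in> carrier R \<Longrightarrow>
      d \<otimes> x \<otimes> e \<otimes> y \<otimes> d \<otimes> z \<otimes> e = \<zero>"
  shows "e \<in> null_ideal_multipliers"
proof -
  have c: "e \<in> carrier R" "d \<in> carrier R" and one: "e \<oplus> d = \<one>"
    using ed by (auto simp: R.complementary_idempotents_def)
  have "coeff_pairing f (\<lambda>i. e \<otimes> a [^] i) = \<zero>" if f: "f \<in> null_ideal R" and a: "a \<in> carrier R" for f a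
  proof -
    define u where "u = e \<otimes> a \<otimes> e \<oplus> e \<otimes> a \<otimes> d \<oplus> d \<otimes> a \<otimes> d"
    define l where "l = d \<otimes> a \<otimes> d \<oplus> d \<otimes> a \<otimes> e \<oplus> e \<otimes> a \<otimes> e"
    define v where "v = e \<otimes> a \<otimes> e \<oplus> d \<otimes> a \<otimes> d"
    have v': "v = d \<otimes> a \<otimes> d \<oplus> e \<otimes> a \<otimes> e" using a c by (simp add: v_def R.a_comm)
    have ulv: "u \<in> carrier R" "l \<in> carrier R" "v \<in> carrier R"
      using a c by (auto simp: u_def l_def v_def)
    have upow: "u [^] i \<otimes> d = e \<otimes> a [^] i \<otimes> d \<oplus> v [^] i \<otimes> d" for i :: nat
      unfolding u_def v_def by (rule R.off_diagonal_block_of_power[OF ed a ede])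
    have lpow: "l [^] i \<otimes> e = d \<otimes> a [^] i \<otimes> e \<oplus> v [^] i \<otimes> e" for i :: nat
      unfolding l_def v'
      by (rule R.off_diagonal_block_of_power[OF R.complementary_idempotents_sym[OF ed] a ded])
    have key: "e \<otimes> a [^] i \<oplus> (v [^] i \<otimes> d \<oplus> l [^] i \<otimes> e) = u [^] i \<otimes> d \<oplus> (a [^] i \<otimes> e \<oplus> v [^] i \<otimes> e)"
      (is "?lhs = ?rhs") for i :: nat
    proof -
      have 1: "e \<otimes> a [^] i = e \<otimes> a [^] i \<otimes> e \<oplus> e \<otimes> a [^] i \<otimes> d"
        using a c one by (simp add: R.r_distr[symmetric])
      have 2: "a [^] i \<otimes> e = e \<otimes> a [^] i \<otimes> e \<oplus> d \<otimes> a [^] i \<otimes> e"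
        using a c one by (simp add: R.l_distr[symmetric] R.m_assoc)
      show ?thesis
        unfolding upow lpow by (subst 1, subst 2) (use a c ulv in \<open>simp add: R.a_ac\<close>)
    qed
    have fP: "f \<in> carrier P" by (rule null_ideal_closed[OF f])
    note null = null_ideal_pairing_pow[OF f]
    have "coeff_pairing f (\<lambda>i. e \<otimes> a [^] i) =
        coeff_pairing f (\<lambda>i. e \<otimes> a [^] i \<oplus> (v [^] i \<otimes> d \<oplus> l [^] i \<otimes> e))"
      using a c ulv fP by (simp add: coeff_pairing_add null)
    also have "\<dots> = coeff_pairing f (\<lambda>i. u [^] i \<otimes> d \<oplus> (a [^] i \<otimes> e \<oplus> v [^] i \<otimes> e))"
      by (simp only: key)
    also have "\<dots> = \<zero>" using a c ulv fP by (simp add: coeff_pairing_add null)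
    finally show ?thesis .
  qed
  then show ?thesis using c by (simp add: null_ideal_multipliers_iff)
qed

lemma null_ideal_multipliers_eq_carrier:
  assumes fin: "finite (carrier R)" and nil: "nilpotency R (jacobson_radical R) \<le> 3"
  shows "null_ideal_multipliers = carrier R"
proof
  show sub: "null_ideal_multipliers \<subseteq> carrier R" by (auto simp: null_ideal_multipliers_def)
  show "carrier R \<subseteq> null_ideal_multipliers"
  proof
    fix r assume r: "r \<in> carrier R"
    show "r \<in> null_ideal_multipliers"
    proof (rule R.generated_by_units_and_idempotents_with_nil_corner[OF fin sub _ _ _ _ _ r])
      fix e d assume ed: "R.complementary_idempotents e d"
        and nilp: "\<And>x y. x \<in> carrier R \<Longrightarrow> y \<in> carrier R \<Longrightarrow> R.nilpotent_elem (e \<otimes> x \<otimes> d \<otimes> y \<otimes> e)"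
      have J: "e \<otimes> x \<otimes> d \<in> jacobson_radical R" "d \<otimes> x \<otimes> e \<in> jacobson_radical R"
        if "x \<in> carrier R" for x
        by (rule R.nilpotent_peirce_in_jacobson_radical[OF ed]; use nilp that in blast)+
      have c: "e \<in> carrier R" "d \<in> carrier R"
        using ed by (auto simp: R.complementary_idempotents_def)
      note i2 = R.complementary_idempotents_idem[OF ed]
      have absorb: "e \<otimes> (e \<otimes> z) = e \<otimes> z" "d \<otimes> (d \<otimes> z) = d \<otimes> z" if "z \<in> carrier R" for z
        using that c i2 by (simp_all add: R.m_assoc[symmetric])
      note triple = R.jacobson_radical_triple_product[OF fin nil]
      show "e \<in> null_ideal_multipliers"
      proof (rule idempotent_null_ideal_multiplier[OF ed])
        fix x y z assume xyz: "x \<in> carrier R" "y \<in> carrier R" "z \<in> carrier R"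
        show "e \<otimes> x \<otimes> d \<otimes> y \<otimes> e \<otimes> z \<otimes> d = \<zero>"
          using triple[OF J(1)[OF xyz(1)] J(2)[OF xyz(2)] J(1)[OF xyz(3)]] xyz c absorb
          by (simp add: R.m_assoc)
        show "d \<otimes> x \<otimes> e \<otimes> y \<otimes> d \<otimes> z \<otimes> e = \<zero>"
          using triple[OF J(2)[OF xyz(1)] J(1)[OF xyz(2)] J(2)[OF xyz(3)]] xyz c absorb
          by (simp add: R.m_assoc)
      qed
    qed (auto simp: null_ideal_multipliers_add null_ideal_multipliers_uminus
          null_ideal_multipliers_mult Units_subset_null_ideal_multipliers[THEN subsetD])
  qed
qed

text \<open>The indeterminate is central, so \<open>(f c x\<^sup>n)(a) = (f c)(a) a\<^sup>n\<close>.\<close>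

lemma null_ideal_right_mult:
  assumes all: "null_ideal_multipliers = carrier R"
    and f: "f \<in> null_ideal R" and p: "p \<in> carrier P"
  shows "f \<otimes>\<^bsub>P\<^esub> p \<in> null_ideal R"
  using p
proof (induction rule: poly_induct)
  case (monom c n)
  have "coeff_pairing f (\<lambda>i. c \<otimes> a [^] (i + n)) = \<zero>" if a: "a \<in> carrier R" for a
  proof -
    have "coeff_pairing f (\<lambda>i. c \<otimes> a [^] (i + n)) = coeff_pairing f (\<lambda>i. c \<otimes> a [^] i) \<otimes> a [^] n"
      using coeff_pairing_mult_const[of "\<lambda>i. c \<otimes> a [^] i" f "a [^] n"] monom a null_ideal_closed[OF f]
      by (simp add: R.m_assoc R.nat_pow_mult)
    moreover have "c \<in> null_ideal_multipliers" using monom all by simp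
    ultimately show ?thesis using monom a f by (simp add: null_ideal_multipliers_iff)
  qed
  then show ?case using monom f by (simp add: null_ideal_iff coeff_pairing_mult_monom)
next
  case (add p q)
  then show ?case using f by (simp add: P.r_distr null_ideal_add null_ideal_closed)
qed

end

theorem theorem1p2:
  fixes R :: "('a, 'm) ring_scheme"
  assumes "ring R"
    and "finite (carrier R)"
    and "nilpotency R (jacobson_radical R) \<le> 3"
  shows "ideal (null_ideal R) (UP R)"
proof -
  interpret UP_ring R "UP R" using assms(1) by (simp add: UP_ring_def)
  note all = null_ideal_multipliers_eq_carrier[OF assms(2,3)]
  show ?thesis
  proof (rule idealI)
    show "ring (UP R)" by (rule UP_ring)
    show "subgroup (null_ideal R) (add_monoid (UP R))"
      using null_ideal_zero
      by (intro P.add.subgroupI)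
        (auto simp: null_ideal_closed null_ideal_add null_ideal_uminus a_inv_def[symmetric])
    fix f p assume "f \<in> null_ideal R" "p \<in> carrier (UP R)"
    then show "p \<otimes>\<^bsub>UP R\<^esub> f \<in> null_ideal R" "f \<otimes>\<^bsub>UP R\<^esub> p \<in> null_ideal R"
      using null_ideal_left_mult null_ideal_right_mult[OF all] by auto
  qed
qed

end
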